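(* Let $a=(a_n)_{n\in\mathbb{N}}$ and $b=(b_n)_{n\in\mathbb{N}}$ be sequences of positive integers, set $a_0=b_0=0$, and suppose the set $\{(a_n,b_n)\mid n\in\mathbb{N}_0\}$ is $b_1$-superadditive-complementary ($b_1$-SAC). Let $G$ be the invariant subtraction game on $\mathbb{N}_0\times\mathbb{N}_0$ with set of moves $\mathcal{M}(G)=\{\{a_n,b_n\}\mid n\in\mathbb{N}\}$. Then $$\mathcal{P}(G^\star)=\mathcal{M}(G)\cup\{(0,0)\}$$ and $(G^\star)^\star=G$.
   Context: $\mathbb{N}$ denotes the positive integers, $\mathbb{N}_0$ the non-negative integers. The game board is $\mathbb{N}_0^2$ with componentwise addition $\oplus$, componentwise subtraction $\ominus$ (defined when $\boldsymbol y\preceq\boldsymbol x$), and componentwise partial order $\preceq$; $\boldsymbol y\prec\boldsymbol x$ means $\boldsymbol y\preceq\boldsymbol x$ and $\boldsymbol y\neq\boldsymbol x$. A (2-pile subtraction) game assigns to each position $\boldsymbol x$ a set of options $F(\boldsymbol x)$ with $\boldsymbol y\in F(\boldsymbol x)\Rightarrow\boldsymbol y\prec\boldsymbol x$; two players alternately move from the current position to an option, and the player making the last move wins. A game is invariant if for all $\boldsymbol x,\boldsymbol y$ and $\boldsymbol r\neq\boldsymbol 0$, $\boldsymbol x\oplus\boldsymbol r\to\boldsymbol x$ is an option whenever $\boldsymbol y\oplus\boldsymbol r\to\boldsymbol y$ is; its set of moves is $\mathcal{M}(G)=\{\boldsymbol r\mid \boldsymbol 0\in F(\boldsymbol r)\}$,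 and then the options of $\boldsymbol x$ are exactly $\boldsymbol x\ominus\boldsymbol r$ for $\boldsymbol r\in\mathcal{M}(G)$ with $\boldsymbol r\preceq\boldsymbol x$; an invariant game is determined by its set of moves. A position is a $P$-position if all its options are $N$-positions, and an $N$-position otherwise; $\mathcal{P}(G)$, $\mathcal{N}(G)$ denote these sets. For any game $G$, $G^\star$ is the invariant game with $\mathcal{M}(G^\star)=\mathcal{P}(G)\setminus\{(0,0)\}$. The notation $\{r,s\}$ for a pair means both ordered pairs $(r,s)$ and $(s,r)$; e.g. $\mathcal{M}(G)=\{\{a_n,b_n\}\}$ means $\mathcal{M}(G)=\{(a_n,b_n),(b_n,a_n)\mid n\in\mathbb{N}\}$. Sequences $(x_n)_{n\in\mathbb{N}}$, $(y_n)_{n\in\mathbb{N}}$ of positive integers are complementary if $\{x_n\}\cup\{y_n\}=\mathbb{N}$ and $\{x_n\}\cap\{y_n\}=\emptyset$. For $t\in\mathbb{N}$, a sequence $(X_n)_{n\in\mathbb{N}_0}$ is $t$-superadditive if $X_m+X_n\le X_{m+n}<X_m+X_n+t$ for all $m,n\in\mathbb{N}_0$. With $a_0=b_0=0$, the set $\{(a_n,b_n)\mid n\in\mathbb{N}_0\}$ is $t$-SAC if: $a_1=1$; $(a_n)_{n\in\mathbb{N}}$ and $(b_n)_{n\in\mathbb{N}}$ are complementary; $a$ is increasing; and $(b_n)_{n\in\mathbb{N}_0}$ is $t$-superadditive. *)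

theory Defs
  imports Main "HOL-Library.Product_Plus" "HOL-Library.Product_Order"
begin

text \<open>
  Positions are pairs of natural numbers. The instances from the two imported theories make
  \<open>+\<close>, \<open>-\<close>, \<open>0\<close> and \<open>\<le>\<close> componentwise on pairs, and \<open>y < x\<close> means \<open>y \<le> x\<close> and \<open>y \<noteq> x\<close>.
  Componentwise \<open>-\<close> truncates on \<open>nat\<close>, so \<open>x - r\<close> is only used when \<open>r \<le> x\<close>.
\<close>

type_synonym position = "nat \<times> nat"

text \<open>A game is its option map, so equality of games is equality of option maps.\<close>

typedef game = "{F :: position \<Rightarrow> position set. \<forall>x y. y \<in> F x \<longrightarrow> y < x}"
  morphisms opts Game
  by (rule exI[of _ "\<lambda>_. {}"]) simp

lemma opts_less: "y \<in> opts G x \<Longrightarrow> y < x"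
  using opts[of G] by blast

definition is_invariant :: "game \<Rightarrow> bool" where
  "is_invariant G \<longleftrightarrow> (\<forall>x y r. r \<noteq> 0 \<longrightarrow> y \<in> opts G (y + r) \<longrightarrow> x \<in> opts G (x + r))"

definition moves :: "game \<Rightarrow> position set" where
  "moves G = {r. 0 \<in> opts G r}"

function P_pos :: "game \<Rightarrow> position \<Rightarrow> bool" where
  "P_pos G x \<longleftrightarrow> (\<forall>y \<in> opts G x. \<not> P_pos G y)"
  by pat_completeness auto
termination
proof (relation "measure (\<lambda>(G, x). fst x + snd x)")
  fix G x y assume "y \<in> opts G x"
  then have "y < x" by (rule opts_less)
  then show "((G, y), (G, x)) \<in> measure (\<lambda>(G, x). fst x + snd x)"
    by (cases x; cases y) (auto simp: less_prod_def)
qed simp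

declare P_pos.simps [simp del]

definition P_positions :: "game \<Rightarrow> position set" where
  "P_positions G = {x. P_pos G x}"

definition N_positions :: "game \<Rightarrow> position set" where
  "N_positions G = - P_positions G"

lemma P_positions_iff: "x \<in> P_positions G \<longleftrightarrow> opts G x \<subseteq> N_positions G"
  unfolding P_positions_def N_positions_def mem_Collect_eq by (subst P_pos.simps) blast

text \<open>The zero vector cannot be a move, hence the guard.\<close>

definition invariant_game :: "position set \<Rightarrow> game" where
  "invariant_game M = Game (\<lambda>x. {x - r | r. r \<in> M \<and> r \<noteq> 0 \<and> r \<le> x})"

lemma diff_less_position: "r \<noteq> 0 \<Longrightarrow> r \<le> x \<Longrightarrow> x - r < x" for r x :: position
  by (cases r; cases x) (auto simp: less_prod_def zero_prod_def)

lemma opts_invariant_game: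
  "opts (invariant_game M) x = {x - r | r. r \<in> M \<and> r \<noteq> 0 \<and> r \<le> x}"
proof -
  have "(\<lambda>x. {x - r | r. r \<in> M \<and> r \<noteq> 0 \<and> r \<le> x})
      \<in> {F :: position \<Rightarrow> position set. \<forall>x y. y \<in> F x \<longrightarrow> y < x}"
    using diff_less_position by blast
  then show ?thesis
    unfolding invariant_game_def by (simp only: Game_inverse)
qed

lemma opts_invariant_game_iff:
  "x \<in> opts (invariant_game M) (x + r) \<longleftrightarrow> r \<in> M \<and> r \<noteq> 0"
proof -
  have key: "x = x + r - s \<and> s \<le> x + r \<longleftrightarrow> s = r" for s
    by (cases r; cases x; cases s) auto
  show ?thesis
    unfolding opts_invariant_game mem_Collect_eq using key by metis
qed

lemma invariant_game_is_invariant: "is_invariant (invariant_game M)"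
  unfolding is_invariant_def by (simp add: opts_invariant_game_iff)

lemma moves_invariant_game: "moves (invariant_game M) = M - {0}"
  unfolding moves_def using opts_invariant_game_iff[of 0] by auto

lemma is_invariant_determined:
  assumes "is_invariant G" and "is_invariant H" and "moves G = moves H"
  shows "G = H"
proof -
  have *: "y \<in> opts K x \<longleftrightarrow> y < x \<and> x - y \<in> moves K" if K: "is_invariant K" for K x y
  proof (cases "y < x")
    case True
    then have eq: "y + (x - y) = x" and nz: "x - y \<noteq> 0"
      by (cases x; cases y; auto simp: less_prod_def zero_prod_def)+
    have "y \<in> opts K (y + (x - y)) \<longleftrightarrow> 0 \<in> opts K (0 + (x - y))"
      using K nz unfolding is_invariant_def by blast
    with True eq show ?thesis by (simp add: moves_def)
  next
    case False
    then show ?thesis using opts_less by blast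
  qed
  have "opts G = opts H"
    using assms by (intro ext set_eqI) (simp add: *)
  then show ?thesis by (simp add: opts_inject)
qed

definition star :: "game \<Rightarrow> game" where
  "star G = invariant_game (P_positions G - {(0, 0)})"

lemma star_unique:
  "H = star G \<longleftrightarrow> is_invariant H \<and> moves H = P_positions G - {(0, 0)}"
proof -
  have "is_invariant (star G)" "moves (star G) = P_positions G - {(0, 0)}"
    by (simp_all add: star_def invariant_game_is_invariant moves_invariant_game zero_prod_def)
  then show ?thesis using is_invariant_determined[of H "star G"] by auto
qed

definition complementary :: "(nat \<Rightarrow> nat) \<Rightarrow> (nat \<Rightarrow> nat) \<Rightarrow> bool" where
  "complementary x y \<longleftrightarrow> x ` {1..} \<union> y ` {1..} = {1..} \<and> x ` {1..} \<inter> y ` {1..} = {}"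

definition superadditive :: "nat \<Rightarrow> (nat \<Rightarrow> nat) \<Rightarrow> bool" where
  "superadditive t X \<longleftrightarrow> (\<forall>m n. X m + X n \<le> X (m + n) \<and> X (m + n) < X m + X n + t)"

text \<open>``Increasing'' is read as strictly increasing.\<close>

definition SAC :: "nat \<Rightarrow> (nat \<Rightarrow> nat) \<Rightarrow> (nat \<Rightarrow> nat) \<Rightarrow> bool" where
  "SAC t a b \<longleftrightarrow> a 0 = 0 \<and> b 0 = 0 \<and> a 1 = 1 \<and> complementary a b \<and>
     strict_mono_on {1..} a \<and> superadditive t b"

end

theory Submission
  imports Defs
begin

text \<open>
  A position \<open>x\<close> outside \<open>moves G \<union> {0}\<close> has an option of \<open>G\<^sup>\<star>\<close> in \<open>moves G \<union> {0}\<close> for free: a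
  \<open>P\<close>-position \<open>x \<noteq> 0\<close> of \<open>G\<close> is itself a move of \<open>G\<^sup>\<star>\<close> from \<open>x\<close> to \<open>0\<close>; and if \<open>x\<close> is an
  \<open>N\<close>-position of \<open>G\<close>, then some move \<open>m\<close> of \<open>G\<close> leads to a \<open>P\<close>-position \<open>x - m \<noteq> 0\<close>, so that
  \<open>x - m\<close> is a move of \<open>G\<^sup>\<star>\<close> from \<open>x\<close> to \<open>m\<close>. So the theorem amounts to showing that the
  difference of two distinct comparable moves of \<open>G\<close> is an \<open>N\<close>-position of \<open>G\<close>.

  Counting the terms of both sequences below \<open>n + m\<close> shows that \<open>a n < n + m\<close> if and only if
  \<open>n + m \<le> b m\<close>. Through this duality, superadditivity of \<open>b\<close> confines \<open>a (p + q) - a p - a q\<close>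
  to \<open>{-1, 0, 1}\<close>. If it is nonnegative, the move \<open>(a q, b q)\<close> takes
  \<open>(a (p + q) - a p, b (p + q) - b p)\<close> into the square \<open>[0, b 1)\<^sup>2\<close>, where \<open>G\<close> has no moves. In
  all remaining cases some move empties one of the piles, and then the game is over as well.
\<close>

lemma diff_diff_cancel_position: "y \<le> x \<Longrightarrow> x - (x - y) = y" for x y :: position
  by (cases x; cases y) auto

lemma diff_le_position: "x - y \<le> x" for x y :: position
  by (cases x; cases y) auto

lemma zero_le_position: "0 \<le> x" for x :: position
  by (cases x) (auto simp: zero_prod_def)

lemma diff_eq_0_iff_position: "y \<le> x \<Longrightarrow> x - y = 0 \<longleftrightarrow> x = y" for x y :: position
  by (cases x; cases y) (auto simp: zero_prod_def)

lemma mem_opts_invariant_game: "y \<in> opts (invariant_game M) x \<longleftrightarrow> y < x \<and> x - y \<in> M"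
proof
  assume "y \<in> opts (invariant_game M) x"
  then obtain r where "y = x - r" "r \<in> M" "r \<noteq> 0" "r \<le> x"
    unfolding opts_invariant_game by blast
  then show "y < x \<and> x - y \<in> M"
    by (simp add: diff_less_position diff_diff_cancel_position)
next
  assume diff_in_M: "y < x \<and> x - y \<in> M"
  then have "y = x - (x - y)" "x - y \<noteq> 0"
    by (auto simp: diff_diff_cancel_position diff_eq_0_iff_position less_imp_le)
  with diff_in_M show "y \<in> opts (invariant_game M) x"
    unfolding opts_invariant_game using diff_le_position by blast
qed

lemma zero_notin_moves: "0 \<notin> moves G"
  using opts_less[of 0 G 0] by (auto simp: moves_def)

lemma invariant_game_moves: "is_invariant G \<Longrightarrow> invariant_game (moves G) = G"
  by (rule is_invariant_determined)
    (simp_all add: invariant_game_is_invariant moves_invariant_game zero_notin_moves)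

lemma mem_opts_invariant:
  "is_invariant G \<Longrightarrow> y \<in> opts G x \<longleftrightarrow> y < x \<and> x - y \<in> moves G"
  using mem_opts_invariant_game[of y "moves G" x] by (simp add: invariant_game_moves)

lemma diff_mem_opts_invariant:
  assumes "is_invariant G" "r \<in> moves G" "r \<le> x"
  shows "x - r \<in> opts G x"
proof -
  have "r \<noteq> 0"
    using assms(2) zero_notin_moves by metis
  then show ?thesis
    using assms by (simp add: mem_opts_invariant diff_less_position diff_diff_cancel_position)
qed

lemma mem_opts_star: "y \<in> opts (star G) x \<longleftrightarrow> y < x \<and> x - y \<in> P_positions G"
  by (auto simp: star_def mem_opts_invariant_game diff_eq_0_iff_position less_imp_le
      simp flip: zero_prod_def)

lemma P_positions_iff_disjoint: "x \<in> P_positions G \<longleftrightarrow> opts G x \<inter> P_positions G = {}"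
  unfolding P_positions_iff[of x] N_positions_def by blast

lemma P_positions_eq_iff:
  "P_positions G = S \<longleftrightarrow> (\<forall>x. x \<in> S \<longleftrightarrow> opts G x \<inter> S = {})"
proof
  assume "P_positions G = S"
  then show "\<forall>x. x \<in> S \<longleftrightarrow> opts G x \<inter> S = {}"
    using P_positions_iff_disjoint by blast
next
  assume "\<forall>x. x \<in> S \<longleftrightarrow> opts G x \<inter> S = {}"
  then have "x \<in> P_positions G \<longleftrightarrow> x \<in> S" for x
  proof (induction G x rule: P_pos.induct[case_names options])
    case (options G x)
    then show ?case
      by (subst P_positions_iff_disjoint) blast
  qed
  then show "P_positions G = S"
    by blast
qed

lemma P_positions_hom:
  assumes "\<And>x. opts H (f x) = f ` opts G x"
  shows "f x \<in> P_positions H \<longleftrightarrow> x \<in> P_positions G"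
  using assms
proof (induction G x rule: P_pos.induct[case_names options])
  case (options G x)
  have "f x \<in> P_positions H \<longleftrightarrow> (\<forall>y \<in> opts G x. f y \<notin> P_positions H)"
    by (subst P_positions_iff_disjoint) (auto simp: options.prems)
  also have "\<dots> \<longleftrightarrow> (\<forall>y \<in> opts G x. y \<notin> P_positions G)"
    using options by blast
  also have "\<dots> \<longleftrightarrow> x \<in> P_positions G"
    by (subst (2) P_positions_iff_disjoint) blast
  finally show ?case .
qed

lemma opts_zero: "opts G 0 = {}"
  using opts_less[of _ G 0] zero_le_position by (auto simp: less_le_not_le)

lemma zero_in_P_positions: "0 \<in> P_positions G"
  by (simp add: P_positions_iff opts_zero)

lemma moves_disjoint_P_positions: "moves G \<inter> P_positions G = {}"
  using zero_in_P_positions[of G] P_positions_iff_disjoint[of _ G] unfolding moves_def by blast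

lemma star_option_in_moves_or_zero:
  assumes "is_invariant G" "x \<notin> moves G" "x \<noteq> 0"
  shows "opts (star G) x \<inter> (moves G \<union> {0}) \<noteq> {}"
proof (cases "x \<in> P_positions G")
  case True
  then have "0 \<in> opts (star G) x"
    using assms(3) zero_le_position[of x] by (simp add: mem_opts_star less_le)
  then show ?thesis
    by blast
next
  case False
  then obtain y where "y \<in> opts G x" and y_in_P: "y \<in> P_positions G"
    by (subst (asm) P_positions_iff_disjoint) blast
  then have y_less: "y < x" and diff_in_moves: "x - y \<in> moves G"
    using assms(1) by (simp_all add: mem_opts_invariant)
  then have "y \<noteq> 0"
    using assms(2) by auto
  then have "x - y \<in> opts (star G) x"
    using y_less y_in_P by (simp add: mem_opts_star diff_less_position diff_diff_cancel_position)
  then show ?thesis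
    using diff_in_moves by blast
qed

lemma P_positions_star_iff:
  assumes "is_invariant G"
  shows "P_positions (star G) = moves G \<union> {0} \<longleftrightarrow>
    (\<forall>x \<in> moves G. \<forall>y \<in> moves G. y < x \<longrightarrow> x - y \<notin> P_positions G)"
    (is "_ \<longleftrightarrow> ?differences_not_P")
proof -
  have "x \<in> moves G \<union> {0} \<longleftrightarrow> opts (star G) x \<inter> (moves G \<union> {0}) = {}"
    if "x \<notin> moves G" for x
    using star_option_in_moves_or_zero[OF assms that] that opts_zero by auto
  then have "P_positions (star G) = moves G \<union> {0} \<longleftrightarrow>
      (\<forall>x \<in> moves G. opts (star G) x \<inter> (moves G \<union> {0}) = {})"
    unfolding P_positions_eq_iff by blast
  also have "\<dots> \<longleftrightarrow> (\<forall>x \<in> moves G. opts (star G) x \<inter> moves G = {})"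
    using moves_disjoint_P_positions[of G] by (fastforce simp: mem_opts_star)
  also have "\<dots> \<longleftrightarrow> ?differences_not_P"
    using mem_opts_star by blast
  finally show ?thesis .
qed

lemma star_star_eq_iff:
  assumes "is_invariant G"
  shows "star (star G) = G \<longleftrightarrow> P_positions (star G) = moves G \<union> {0}"
proof -
  have "star (star G) = G \<longleftrightarrow> moves G = P_positions (star G) - {0}"
    unfolding eq_commute[of _ G] star_unique[of G "star G"] zero_prod_def using assms by blast
  also have "\<dots> \<longleftrightarrow> P_positions (star G) = moves G \<union> {0}"
    using zero_notin_moves[of G] zero_in_P_positions[of "star G"] by blast
  finally show ?thesis .
qed

lemma P_positions_if_no_move:
  assumes "is_invariant G" and "\<And>r. r \<in> moves G \<Longrightarrow> \<not> r \<le> x"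
  shows "x \<in> P_positions G"
  unfolding P_positions_iff using assms mem_opts_invariant diff_le_position by blast

lemma not_P_if_move_to_P:
  assumes "is_invariant G" "r \<in> moves G" "r \<le> x" "x - r \<in> P_positions G"
  shows "x \<notin> P_positions G"
  using diff_mem_opts_invariant[OF assms(1-3)] assms(4) P_positions_iff_disjoint[of x G] by blast

lemma P_positions_swap_iff:
  assumes "is_invariant G" and "\<And>r. prod.swap r \<in> moves G \<longleftrightarrow> r \<in> moves G"
  shows "prod.swap x \<in> P_positions G \<longleftrightarrow> x \<in> P_positions G"
proof (rule P_positions_hom)
  fix x
  have "y \<in> opts G (prod.swap x) \<longleftrightarrow> prod.swap y \<in> opts G x" for y
  proof -
    have "y < prod.swap x \<longleftrightarrow> prod.swap y < x" "x - prod.swap y = prod.swap (prod.swap x - y)"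
      by (cases x; cases y; auto simp: less_prod_def)+
    then show ?thesis
      using assms by (simp add: mem_opts_invariant)
  qed
  then show "opts G (prod.swap x) = prod.swap ` opts G x"
    by (intro set_eqI) (metis image_iff swap_swap)
qed

lemma superadditive_le: "superadditive t X \<Longrightarrow> X m + X n \<le> X (m + n)"
  and superadditive_less: "superadditive t X \<Longrightarrow> X (m + n) < X m + X n + t"
  by (auto simp: superadditive_def)

lemma superadditive_mult_le: "superadditive t X \<Longrightarrow> m * X n \<le> X (m * n)"
proof (induction m)
  case (Suc m)
  then show ?case
    using superadditive_le[of t X n "m * n"] by simp
qed simp

lemma superadditive_strict_mono:
  assumes "superadditive t X" "X 1 > 0"
  shows "strict_mono X"
  unfolding strict_mono_Suc_iff
proof
  show "X n < X (Suc n)" for n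
    using superadditive_le[OF assms(1), of n 1] assms(2) by simp
qed

lemma complementary_neq: "complementary x y \<Longrightarrow> 1 \<le> m \<Longrightarrow> 1 \<le> n \<Longrightarrow> x m \<noteq> y n"
  by (force simp: complementary_def)

lemma complementary_pos:
  assumes "complementary x y" "1 \<le> n"
  shows "1 \<le> x n" "1 \<le> y n"
  using assms unfolding complementary_def by blast+

lemma complementary_cases:
  assumes "complementary x y" "1 \<le> i"
  obtains (left) n where "1 \<le> n" "i = x n" | (right) n where "1 \<le> n" "i = y n"
proof -
  have "i \<in> x ` {1..} \<union> y ` {1..}"
    using assms by (simp add: complementary_def)
  then show ?thesis
    using that by auto
qed

context
  fixes x y :: "nat \<Rightarrow> nat" and n m :: nat
  assumes compl: "complementary x y"
    and x_mono: "strict_mono_on {1..} x" and y_mono: "strict_mono_on {1..} y"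
    and n_ge_1: "1 \<le> n" and m_ge_1: "1 \<le> m"
begin

lemma complementary_not_both_less_add: "\<not> (x n < n + m \<and> y m < n + m)"
proof
  assume both_less: "x n < n + m \<and> y m < n + m"
  have x_below: "x k \<in> {1..<n + m}" if "k \<in> {1..n}" for k
    using that both_less complementary_pos(1)[OF compl, of k] strict_mono_on_leD[OF x_mono, of k n]
    by simp
  have y_below: "y k \<in> {1..<n + m}" if "k \<in> {1..m}" for k
    using that both_less complementary_pos(2)[OF compl, of k] strict_mono_on_leD[OF y_mono, of k m]
    by simp
  have "card (x ` {1..n}) = n" "card (y ` {1..m}) = m"
    using strict_mono_on_imp_inj_on[OF x_mono] strict_mono_on_imp_inj_on[OF y_mono]
    by (simp_all add: card_image inj_on_subset)
  moreover have "x ` {1..n} \<inter> y ` {1..m} = {}"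
    using complementary_neq[OF compl] by auto
  ultimately have "n + m = card (x ` {1..n} \<union> y ` {1..m})"
    by (simp add: card_Un_disjoint)
  also have "\<dots> \<le> card {1..<n + m}"
    using x_below y_below by (intro card_mono) blast+
  finally show False
    using n_ge_1 by simp
qed

lemma complementary_not_both_ge_add: "\<not> (n + m \<le> x n \<and> n + m \<le> y m)"
proof
  assume both_ge: "n + m \<le> x n \<and> n + m \<le> y m"
  have "{1..<n + m} \<subseteq> x ` {1..<n} \<union> y ` {1..<m}"
  proof
    fix i assume i_below: "i \<in> {1..<n + m}"
    then have "1 \<le> i"
      by simp
    with compl show "i \<in> x ` {1..<n} \<union> y ` {1..<m}"
    proof (cases rule: complementary_cases)
      case (left k)
      then have "k < n"
        using i_below both_ge n_ge_1 strict_mono_on_leD[OF x_mono, of n k] by force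
      then show ?thesis
        using left by simp
    next
      case (right k)
      then have "k < m"
        using i_below both_ge m_ge_1 strict_mono_on_leD[OF y_mono, of m k] by force
      then show ?thesis
        using right by simp
    qed
  qed
  then have "card {1..<n + m} \<le> card (x ` {1..<n} \<union> y ` {1..<m})"
    by (intro card_mono) auto
  also have "\<dots> \<le> card (x ` {1..<n}) + card (y ` {1..<m})"
    by (rule card_Un_le)
  also have "\<dots> \<le> (n - 1) + (m - 1)"
    using card_image_le[of "{1..<n}" x] card_image_le[of "{1..<m}" y] by simp
  finally show False
    using n_ge_1 m_ge_1 by simp
qed

lemma complementary_less_add_iff: "x n < n + m \<longleftrightarrow> n + m \<le> y m"
  using complementary_not_both_less_add complementary_not_both_ge_add by linarith

end

locale SAC_pair =
  fixes a b :: "nat \<Rightarrow> nat"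
  assumes SAC: "SAC (b 1) a b"
begin

lemma complementary: "complementary a b"
  and superadditive: "superadditive (b 1) b"
  and a_strict_mono: "strict_mono_on {1..} a"
  and a_1: "a 1 = 1"
  and b_0: "b 0 = 0"
  using SAC by (simp_all add: SAC_def)

lemmas a_neq_b = complementary_neq[OF complementary]
  and a_pos = complementary_pos(1)[OF complementary]
  and b_pos = complementary_pos(2)[OF complementary]
  and b_add_le = superadditive_le[OF superadditive]
  and b_add_less = superadditive_less[OF superadditive]

lemma b_1_ge_2: "2 \<le> b 1"
  using a_neq_b[of 1 1] a_1 b_pos[of 1] by simp

lemma b_strict_mono: "strict_mono b"
  using superadditive_strict_mono[OF superadditive] b_1_ge_2 by simp

lemma b_mono: "m \<le> n \<Longrightarrow> b m \<le> b n"
  using b_strict_mono by (simp add: strict_mono_less_eq)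

lemma a_less_iff: "1 \<le> m \<Longrightarrow> 1 \<le> n \<Longrightarrow> a m < a n \<longleftrightarrow> m < n"
  using strict_mono_on_less[OF a_strict_mono] by simp

lemma a_less_add_iff: "1 \<le> n \<Longrightarrow> 1 \<le> m \<Longrightarrow> a n < n + m \<longleftrightarrow> n + m \<le> b m"
  using complementary a_strict_mono monotone_on_subset[OF b_strict_mono subset_UNIV]
  by (rule complementary_less_add_iff)

lemma le_a: "1 \<le> n \<Longrightarrow> n \<le> a n"
proof (induction n rule: dec_induct)
  case base
  show ?case
    using a_1 by simp
next
  case (step n)
  then show ?case
    using a_less_iff[of n "Suc n"] by simp
qed

lemma a_excess:
  assumes "1 \<le> n"
  obtains k where "a n = n + k" "b k < n + k" "n + k < b (Suc k)"
proof
  show a_eq: "a n = n + (a n - n)"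
    using le_a assms by simp
  then show "n + (a n - n) < b (Suc (a n - n))"
    using a_less_add_iff[of n "Suc (a n - n)"] assms by simp
  show "b (a n - n) < n + (a n - n)"
    using a_less_add_iff[of n "a n - n"] a_eq assms b_0 by (cases "a n - n = 0") auto
qed

lemma a_add_le:
  assumes "1 \<le> p" "1 \<le> q"
  shows "a (p + q) \<le> a p + a q + 1"
proof -
  obtain k where p_excess: "a p = p + k" "p + k < b (Suc k)"
    using assms(1) by (rule a_excess)
  obtain l where q_excess: "a q = q + l" "q + l < b (Suc l)"
    using assms(2) by (rule a_excess)
  have "(p + q) + (k + l + 2) \<le> b (k + l + 2)"
    using p_excess q_excess b_add_le[of "Suc k" "Suc l"] by simp
  then have "a (p + q) < (p + q) + (k + l + 2)"
    using a_less_add_iff[of "p + q" "k + l + 2"] assms by simp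
  then show ?thesis
    using p_excess q_excess by simp
qed

lemma le_a_add:
  assumes "1 \<le> p" "1 \<le> q"
  shows "a p + a q \<le> a (p + q) + 1"
proof -
  obtain k where p_excess: "a p = p + k" "b k < p + k"
    using assms(1) by (rule a_excess)
  obtain l where q_excess: "a q = q + l" "b l < q + l"
    using assms(2) by (rule a_excess)
  have "p + q + (k + l - 1) \<le> a (p + q)"
  proof (cases "k + l \<le> 1")
    case True
    then show ?thesis
      using le_a[of "p + q"] assms by simp
  next
    case False
    define m where "m = k + l - 1"
    have m_ge_1: "1 \<le> m" and Suc_m: "m + 1 = k + l"
      using False by (simp_all add: m_def)
    have "b m + b 1 < b k + b l + b 1"
      using b_add_le[of m 1] b_add_less[of k l] Suc_m by simp
    then have "\<not> p + q + m \<le> b m"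
      using p_excess q_excess Suc_m by simp
    then show ?thesis
      using a_less_add_iff[of "p + q" m] assms m_ge_1 by (simp add: m_def)
  qed
  then show ?thesis
    using p_excess q_excess by simp
qed

lemma a_less_b:
  assumes "1 \<le> n"
  shows "a n < b n"
proof -
  have "n * 2 \<le> n * b 1"
    using b_1_ge_2 by simp
  also have "\<dots> \<le> b n"
    using superadditive_mult_le[OF superadditive, of n 1] by simp
  finally have "n + n \<le> b n"
    by simp
  then show ?thesis
    using a_less_add_iff[of n n] assms by simp
qed

end

locale SAC_game = SAC_pair a b for a b +
  fixes G :: game
  assumes invariant: "is_invariant G"
    and moves_eq: "moves G = {(a n, b n) | n. n \<ge> 1} \<union> {(b n, a n) | n. n \<ge> 1}"
begin

lemma moves_cases:
  assumes "r \<in> moves G"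
  obtains (ab) n where "1 \<le> n" "r = (a n, b n)" | (ba) n where "1 \<le> n" "r = (b n, a n)"
  using assms by (auto simp: moves_eq)

lemma ab_in_moves: "1 \<le> n \<Longrightarrow> (a n, b n) \<in> moves G"
  and ba_in_moves: "1 \<le> n \<Longrightarrow> (b n, a n) \<in> moves G"
  by (auto simp: moves_eq)

lemma swap_in_moves_iff: "prod.swap r \<in> moves G \<longleftrightarrow> r \<in> moves G"
  by (cases r) (auto simp: moves_eq)

lemma empty_pile_P: "(0, j) \<in> P_positions G"
proof (rule P_positions_if_no_move[OF invariant])
  show "\<not> r \<le> (0, j)" if "r \<in> moves G" for r
    using that by (cases rule: moves_cases) (use a_pos b_pos in force)+
qed

lemma small_square_P:
  assumes "i < b 1" "j < b 1"
  shows "(i, j) \<in> P_positions G"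
proof (rule P_positions_if_no_move[OF invariant])
  show "\<not> r \<le> (i, j)" if "r \<in> moves G" for r
    using that
  proof (cases rule: moves_cases)
    case (ab n)
    then show ?thesis
      using b_mono[of 1 n] assms by simp
  next
    case (ba n)
    then show ?thesis
      using b_mono[of 1 n] assms by simp
  qed
qed

lemma first_pile_move_not_P:
  assumes "(i, s) \<in> moves G" "s \<le> j"
  shows "(i, j) \<notin> P_positions G"
  using not_P_if_move_to_P[OF invariant assms(1), of "(i, j)"] assms(2) empty_pile_P by simp

lemma first_pile_le_not_P:
  assumes "1 \<le> i" "i \<le> j" and a_partner_le: "\<And>s. 1 \<le> s \<Longrightarrow> i = a s \<Longrightarrow> b s \<le> j"
  shows "(i, j) \<notin> P_positions G"
  using complementary assms(1)
proof (cases rule: complementary_cases)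
  case (left s)
  then show ?thesis
    using first_pile_move_not_P[of i "b s"] ab_in_moves a_partner_le by simp
next
  case (right s)
  then show ?thesis
    using first_pile_move_not_P[of i "a s"] ba_in_moves a_less_b[of s] \<open>i \<le> j\<close> by simp
qed

lemma diff_ab_ab_not_P:
  assumes p: "1 \<le> p" and q: "1 \<le> q"
  shows "(a (p + q) - a p, b (p + q) - b p) \<notin> P_positions G"
proof (cases "a p + a q \<le> a (p + q)")
  case True
  have "(a (p + q) - a p - a q, b (p + q) - b p - b q) \<in> P_positions G"
    using a_add_le[OF p q] b_add_less[of p q] b_1_ge_2 by (intro small_square_P) linarith+
  then show ?thesis
    using True b_add_le[of p q]
    by (intro not_P_if_move_to_P[OF invariant ab_in_moves[OF q]]) auto
next
  case False
  then have a_diff: "a (p + q) - a p = a q - 1"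
    using le_a_add[OF p q] by linarith
  have b_diff: "b q \<le> b (p + q) - b p"
    using b_add_le[of p q] by linarith
  show ?thesis
  proof (rule first_pile_le_not_P)
    show "1 \<le> a (p + q) - a p"
      using a_less_iff[of p "p + q"] p q by simp
    show "a (p + q) - a p \<le> b (p + q) - b p"
      using a_diff b_diff a_less_b[OF q] by linarith
    show "b s \<le> b (p + q) - b p" if "1 \<le> s" "a (p + q) - a p = a s" for s
    proof -
      have "a s < a q"
        using that a_diff a_pos[OF q] by linarith
      then have "b s \<le> b q"
        using a_less_iff that q b_mono by simp
      then show ?thesis
        using b_diff by linarith
    qed
  qed
qed

lemma diff_ab_ba_not_P:
  assumes n: "1 \<le> n" and m: "1 \<le> m" and b_le_a: "b n \<le> a m"
  shows "(a m - b n, b m - a n) \<notin> P_positions G"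
proof (rule first_pile_le_not_P)
  show "1 \<le> a m - b n"
    using a_neq_b[OF m n] b_le_a by linarith
  show "a m - b n \<le> b m - a n"
    using a_less_b[OF n] a_less_b[OF m] by linarith
  show "b s \<le> b m - a n" if s: "1 \<le> s" and a_diff: "a m - b n = a s" for s
  proof -
    have "a s < a m"
      using a_diff b_pos[OF n] b_le_a by linarith
    then have "s < m"
      using a_less_iff s m by simp
    then obtain q where q: "1 \<le> q" and m_eq: "m = s + q"
      using that[of "m - s"] by simp
    have "a m \<le> a s + a q + 1" "b s + b q \<le> b m"
      using a_add_le b_add_le s q m_eq by simp_all
    then show ?thesis
      using a_diff b_le_a a_less_b[OF n] a_less_b[OF q] by linarith
  qed
qed

lemma diff_ab_not_P:
  assumes m: "1 \<le> m" and y_move: "y \<in> moves G" and less: "y < (a m, b m)"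
  shows "(a m, b m) - y \<notin> P_positions G"
  using y_move
proof (cases rule: moves_cases)
  case (ab n)
  then have "n < m"
    using less a_less_iff[of m n] m by (force simp: less_le)
  then show ?thesis
    using diff_ab_ab_not_P[of n "m - n"] ab by simp
next
  case (ba n)
  then show ?thesis
    using diff_ab_ba_not_P[of n m] m less by (simp add: less_le)
qed

lemma diff_moves_not_P:
  assumes x_move: "x \<in> moves G" and y_move: "y \<in> moves G" and less: "y < x"
  shows "x - y \<notin> P_positions G"
  using x_move
proof (cases rule: moves_cases)
  case (ab m)
  then show ?thesis
    using diff_ab_not_P y_move less by simp
next
  case (ba m)
  have "prod.swap y < (a m, b m)"
    using less ba by (cases y) (auto simp: less_le)
  then have "(a m, b m) - prod.swap y \<notin> P_positions G"
    using ba y_move by (intro diff_ab_not_P) (simp_all add: swap_in_moves_iff)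
  moreover have "(a m, b m) - prod.swap y = prod.swap (x - y)"
    using ba by (cases y) simp
  ultimately show ?thesis
    using P_positions_swap_iff[OF invariant swap_in_moves_iff] by simp
qed

end

theorem theorem1p2:
  fixes a b :: "nat \<Rightarrow> nat" and G :: game
  assumes "\<And>n. n \<ge> 1 \<Longrightarrow> a n > 0" and "\<And>n. n \<ge> 1 \<Longrightarrow> b n > 0"
    and "a 0 = 0" and "b 0 = 0"
    and "SAC (b 1) a b"
    and "is_invariant G"
    and "moves G = {(a n, b n) | n. n \<ge> 1} \<union> {(b n, a n) | n. n \<ge> 1}"
  shows "P_positions (star G) = moves G \<union> {(0, 0)} \<and> star (star G) = G"
proof -
  interpret SAC_game a b G
    by unfold_locales (fact assms)+
  have "P_positions (star G) = moves G \<union> {0}"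
    using P_positions_star_iff[OF invariant] diff_moves_not_P by blast
  then show ?thesis
    using star_star_eq_iff[OF invariant] by (simp add: zero_prod_def)
qed

end
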